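(* Let $X$ be a metric space, let $A\subseteq X^d$ be a closed subset of $X$ (where $X^d$ is the set of non-isolated points of $X$), let $a>b>2$ and $c\ge 1$ be real numbers, and let $f\colon X\to\mathbb{R}$ be a Takagi--van der Waerden function of monotone type $(a,b,c)$ centered at $A$. Then $$L^{\infty}(f)=\mathbb{L}^{\infty}(f)=A.$$
   Context: Let $X$ be a metric space with metric $|\cdot-\cdot|_X$; $B(x,r)$ is the open ball, $X^d$ is the set of non-isolated points of $X$. For $A\subseteq X$, $d(x,A)=\inf_{y\in A}|x-y|_X$ (with $d(x,\varnothing)=+\infty$) and $B(A,r)=\{x\in X: d(x,A)<r\}$. Convention: $\sup\varnothing=0$. Lipschitz derivatives. For $f\colon X\to\mathbb{R}$ and $x\in X$: the big Lipschitz derivative is $\operatorname{Lip}f(x)=\limsup_{r\to0^+}\frac1r\sup_{u\in B(x,r)}|f(x)-f(u)|$; the local Lipschitz derivative is $\mathbb{L}\mathrm{ip}f(x)=\inf_{r>0}\ \sup_{u,v\in B(x,r),\,u\ne v}\frac{|f(u)-f(v)|}{|u-v|_X}$. Both are $0$ at isolated points. Put $L^\infty(f)=\{x\in X:\operatorname{Lip}f(x)=\infty\}$ and $\mathbb{L}^\infty(f)=\{x\in X:\mathbb{L}\mathrm{ip}f(x)=\infty\}$. Separated sets. A subset $S$ of a metric space $Y$ is $\varepsilon$-separated if $|s-t|\ge\varepsilon$ for any distinct $s,t\in S$; it is maximal $\varepsilon$-separated in $Y$ if it is $\varepsilon$-separated and every $\varepsilon$-separated $T$ with $S\subseteq T\subseteq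 Y$ equals $S$. Centered Takagi--van der Waerden functions. Let $A\subseteq X$ be closed, $a>b\ge1$ and $c>0$. A Takagi--van der Waerden function (TW-function) of type $(a,b,c)$ centered at $A$ is a function $f\colon X\to\mathbb{R}$ of the form $f(x)=\sum_{n=0}^\infty b^n d(x,T_n)$, where for each integer $n\ge0$: $G_n=B(A,c/a^n)$, $S_n$ is some maximal $\frac1{a^n}$-separated set in $G_n$, and $T_n=(X\setminus G_n)\cup S_n$. It is said to be of monotone type $(a,b,c)$ if moreover the sequence of sets $(T_n)_{n\ge0}$ is ascending, i.e. $T_n\subseteq T_{n+1}$ for all $n\geq 0$. *)

theory Defs
  imports "HOL-Analysis.Analysis"
begin

text \<open>
  The metric space is the type \<open>'a::metric_space\<close>.  Quantities that may be infinite are valued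
  in \<^typ>\<open>ennreal\<close>, where \<open>Sup {} = 0\<close>, so the convention that the empty supremum is 0 is built in.
\<close>

definition big_Lip :: "('a::metric_space \<Rightarrow> real) \<Rightarrow> 'a \<Rightarrow> ennreal" where
  "big_Lip f x =
     Limsup (at_right 0) (\<lambda>r::real. ennreal (1 / r) * (SUP u\<in>ball x r. ennreal \<bar>f x - f u\<bar>))"

definition local_Lip :: "('a::metric_space \<Rightarrow> real) \<Rightarrow> 'a \<Rightarrow> ennreal" where
  "local_Lip f x =
     (INF r\<in>{0::real<..}. SUP (u, v)\<in>{(u, v). u \<in> ball x r \<and> v \<in> ball x r \<and> u \<noteq> v}.
        ennreal (\<bar>f u - f v\<bar> / dist u v))"

definition big_Lip_infinity :: "('a::metric_space \<Rightarrow> real) \<Rightarrow> 'a set" where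
  "big_Lip_infinity f = {x. big_Lip f x = \<infinity>}"

definition local_Lip_infinity :: "('a::metric_space \<Rightarrow> real) \<Rightarrow> 'a set" where
  "local_Lip_infinity f = {x. local_Lip f x = \<infinity>}"

definition non_isolated :: "'a::metric_space set" where
  "non_isolated = {x. \<not> x isolated_in UNIV}"

text \<open>
  The library has \<open>infdist x {} = 0\<close>, whereas here the distance to the empty set is infinite,
  so that the neighbourhood of the empty set is empty.
\<close>

definition set_ball :: "'a::metric_space set \<Rightarrow> real \<Rightarrow> 'a set" where
  "set_ball A r = {x. A \<noteq> {} \<and> infdist x A < r}"

definition eps_separated :: "real \<Rightarrow> 'a::metric_space set \<Rightarrow> bool" where
  "eps_separated \<epsilon> S \<longleftrightarrow> (\<forall>s\<in>S. \<forall>t\<in>S. s \<noteq> t \<longrightarrow> dist s t \<ge> \<epsilon>)"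

definition maximal_separated :: "real \<Rightarrow> 'a::metric_space set \<Rightarrow> 'a set \<Rightarrow> bool" where
  "maximal_separated \<epsilon> Y S \<longleftrightarrow>
     S \<subseteq> Y \<and> eps_separated \<epsilon> S \<and>
     (\<forall>T. S \<subseteq> T \<and> T \<subseteq> Y \<and> eps_separated \<epsilon> T \<longrightarrow> T = S)"

definition TW_nbhd :: "real \<Rightarrow> real \<Rightarrow> 'a::metric_space set \<Rightarrow> nat \<Rightarrow> 'a set" where
  "TW_nbhd a c A n = set_ball A (c / a ^ n)"

definition TW_set :: "real \<Rightarrow> real \<Rightarrow> 'a::metric_space set \<Rightarrow> (nat \<Rightarrow> 'a set) \<Rightarrow> nat \<Rightarrow> 'a set" where
  "TW_set a c A S n = (UNIV - TW_nbhd a c A n) \<union> S n"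

text \<open>
  \<open>TW_representation a b c A S f\<close>: \<open>f\<close> is a TW-function of type \<open>(a, b, c)\<close> centered at \<open>A\<close>,
  represented by the maximal separated sets \<open>S n\<close>.  Using \<^const>\<open>infdist\<close> in the series is harmless,
  since the sets \<open>TW_set a c A S n\<close> are never empty (lemma \<open>TW_set_nonempty\<close> below).
\<close>

definition TW_representation ::
    "real \<Rightarrow> real \<Rightarrow> real \<Rightarrow> 'a::metric_space set \<Rightarrow> (nat \<Rightarrow> 'a set) \<Rightarrow> ('a \<Rightarrow> real) \<Rightarrow> bool" where
  "TW_representation a b c A S f \<longleftrightarrow>
     closed A \<and> a > b \<and> b \<ge> 1 \<and> c > 0 \<and>
     (\<forall>n. maximal_separated (1 / a ^ n) (TW_nbhd a c A n) (S n)) \<and>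
     (\<forall>x. (\<lambda>n. b ^ n * infdist x (TW_set a c A S n)) sums f x)"

definition TW_function ::
    "real \<Rightarrow> real \<Rightarrow> real \<Rightarrow> 'a::metric_space set \<Rightarrow> ('a \<Rightarrow> real) \<Rightarrow> bool" where
  "TW_function a b c A f \<longleftrightarrow> (\<exists>S. TW_representation a b c A S f)"

definition monotone_TW_function ::
    "real \<Rightarrow> real \<Rightarrow> real \<Rightarrow> 'a::metric_space set \<Rightarrow> ('a \<Rightarrow> real) \<Rightarrow> bool" where
  "monotone_TW_function a b c A f \<longleftrightarrow>
     (\<exists>S. TW_representation a b c A S f \<and>
          (\<forall>n. TW_set a c A S n \<subseteq> TW_set a c A S (Suc n)))"

lemma TW_set_nonempty:
  assumes "maximal_separated (1 / a ^ n) (TW_nbhd a c A n) (S n)"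
  shows "TW_set a c A S n \<noteq> {}"
proof
  assume empty: "TW_set a c A S n = {}"
  then have S: "S n = {}" and G: "TW_nbhd a c A n = UNIV"
    by (auto simp: TW_set_def)
  have "eps_separated (1 / a ^ n) {undefined :: 'a}"
    by (simp add: eps_separated_def)
  with assms S G have "{undefined :: 'a} = {}"
    unfolding maximal_separated_def by (metis empty_subsetI subset_UNIV)
  then show False by simp
qed

end

theory Submission imports Defs begin

text \<open>
  Off \<open>A\<close> the function is harmless: near a point \<open>x \<notin> A\<close> only finitely many of the
  neighbourhoods \<open>G\<^sub>n\<close> are met, and outside \<open>G\<^sub>n\<close> the \<open>n\<close>-th summand vanishes, so \<open>f\<close> is locally
  a finite sum of Lipschitz functions (\<open>local_Lip_finite_off_center\<close>).  Since the big Lipschitz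
  derivative is dominated by the local one (\<open>big_Lip_le_local_Lip\<close>), it remains to find
  arbitrarily large difference quotients of \<open>f\<close> at every \<open>x \<in> A\<close>.

  The key is \<open>TW_difference_lower_bound\<close>.  The sets \<open>T\<^sub>n\<close> increase, so once \<open>t\<close> belongs to \<open>T\<^sub>N\<close>
  all summands from \<open>N\<close> on vanish at \<open>t\<close> and are nonnegative elsewhere; passing from \<open>t\<close> to
  another point \<open>u\<close> gains at least \<open>b\<^sup>n d(u, T\<^sub>n)\<close> for any chosen \<open>n \<ge> N\<close>, and the Lipschitz
  summands below \<open>N\<close> lose at most \<open>(\<Sum>k<N. b\<^sup>k) |u - t|\<close>.  This is used in two ways.

  If \<open>x\<close> lies in some \<open>T\<^sub>N\<close>, put \<open>t = x\<close>.  The loss factor is then a constant, while for every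
  \<open>n \<ge> N\<close> the point \<open>x\<close> is isolated in \<open>T\<^sub>n\<close> at scale \<open>1 / a\<^sup>n\<close>, so that \<open>d(u, T\<^sub>n) = |u - x|\<close>
  for \<open>u\<close> near \<open>x\<close>: the quotients are at least \<open>b\<^sup>n\<close> minus a constant, and non-isolatedness of
  \<open>x\<close> provides such points \<open>u \<noteq> x\<close>.

  If \<open>x\<close> lies in no \<open>T\<^sub>n\<close>, put \<open>u = x\<close> and let \<open>t \<in> T\<^sub>n\<close> realise \<open>d(x, T\<^sub>n)\<close> up to a factor
  \<open>K > 1\<close>, with \<open>N = n\<close>.  The gain is at least \<open>b\<^sup>n |x - t| / K\<close> and the loss at most
  \<open>b\<^sup>n |x - t| / (b - 1)\<close>.  As \<open>b > 2\<close>, one can take \<open>K < b - 1\<close>, and the quotient is at least a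
  fixed positive multiple of \<open>b\<^sup>n\<close>.
\<close>

section \<open>The two Lipschitz derivatives\<close>

lemma big_Lip_le_local_Lip: "big_Lip f x \<le> local_Lip f x"
  unfolding local_Lip_def
proof (rule INF_greatest)
  fix r :: real
  assume "r \<in> {0<..}"
  then have r: "r > 0" by simp
  define Q where "Q = (SUP (u, v)\<in>{(u, v). u \<in> ball x r \<and> v \<in> ball x r \<and> u \<noteq> v}.
      ennreal (\<bar>f u - f v\<bar> / dist u v))"
  have "ennreal (1 / s) * (SUP u\<in>ball x s. ennreal \<bar>f x - f u\<bar>) \<le> Q" if s: "0 < s" "s < r" for s
  proof -
    have "ennreal \<bar>f x - f u\<bar> \<le> ennreal s * Q" if u: "u \<in> ball x s" for u
    proof (cases "u = x")
      case False
      have "ennreal \<bar>f x - f u\<bar> \<le> ennreal (s * (\<bar>f x - f u\<bar> / dist x u))"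
      proof (rule ennreal_leI)
        have "dist x u * \<bar>f x - f u\<bar> \<le> s * \<bar>f x - f u\<bar>"
          using u by (intro mult_right_mono) auto
        then show "\<bar>f x - f u\<bar> \<le> s * (\<bar>f x - f u\<bar> / dist x u)"
          using False by (simp add: field_simps)
      qed
      also have "\<dots> = ennreal s * ennreal (\<bar>f x - f u\<bar> / dist x u)"
        using s by (intro ennreal_mult) auto
      also have "\<dots> \<le> ennreal s * Q"
        unfolding Q_def using False u s r
        by (intro mult_left_mono SUP_upper2[where i="(x, u)"]) auto
      finally show ?thesis .
    qed simp
    then have "ennreal (1 / s) * (SUP u\<in>ball x s. ennreal \<bar>f x - f u\<bar>)
        \<le> ennreal (1 / s) * (ennreal s * Q)"
      by (intro mult_left_mono SUP_least) auto
    also have "\<dots> = Q"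
      using s by (simp add: mult.assoc[symmetric] ennreal_mult[symmetric])
    finally show ?thesis .
  qed
  then show "big_Lip f x \<le> Q"
    unfolding big_Lip_def
    by (intro Limsup_bounded) (auto simp: eventually_at_right_field intro!: exI[of _ r] r)
qed

lemma big_Lip_infinite_if_unbounded_quotients:
  assumes quot: "\<And>M \<delta>. \<delta> > 0 \<Longrightarrow> \<exists>u. u \<noteq> x \<and> dist u x < \<delta> \<and> M * dist u x \<le> \<bar>f x - f u\<bar>"
  shows "big_Lip f x = \<infinity>"
proof (rule ccontr)
  assume "big_Lip f x \<noteq> \<infinity>"
  then obtain C where C: "big_Lip f x < ennreal C" "C \<ge> 0"
    using ennreal_Ex_less_of_nat[of "big_Lip f x"]
    by (auto simp: ennreal_of_nat_eq_real_of_nat less_top)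
  then have "\<forall>\<^sub>F r in at_right 0. ennreal (1 / r) * (SUP u\<in>ball x r. ennreal \<bar>f x - f u\<bar>) < ennreal C"
    unfolding big_Lip_def by (intro Limsup_lessD)
  then obtain \<delta> where \<delta>: "\<delta> > 0"
    "\<And>r. 0 < r \<Longrightarrow> r < \<delta> \<Longrightarrow> ennreal (1 / r) * (SUP u\<in>ball x r. ennreal \<bar>f x - f u\<bar>) < ennreal C"
    unfolding eventually_at_right_field by auto
  obtain u where u: "u \<noteq> x" "dist u x < \<delta> / 2" "2 * C * dist u x \<le> \<bar>f x - f u\<bar>"
    using quot[of "\<delta> / 2" "2 * C"] \<delta>(1) by auto
  \<comment> \<open>Balls are open, so a radius slightly larger than \<open>dist u x\<close> is needed to capture \<open>u\<close>;
     doubling it costs the factor 2 in the choice of \<open>u\<close>.\<close>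
  define r where "r = 2 * dist u x"
  have r: "0 < r" "r < \<delta>" "u \<in> ball x r"
    using u by (auto simp: r_def dist_commute)
  have "ennreal C \<le> ennreal (1 / r * \<bar>f x - f u\<bar>)"
    using u r by (intro ennreal_leI) (auto simp: r_def field_simps)
  also have "\<dots> = ennreal (1 / r) * ennreal \<bar>f x - f u\<bar>"
    using r by (intro ennreal_mult) auto
  also have "\<dots> \<le> ennreal (1 / r) * (SUP u\<in>ball x r. ennreal \<bar>f x - f u\<bar>)"
    using r by (intro mult_left_mono SUP_upper) auto
  also have "\<dots> < ennreal C"
    using \<delta>(2) r by blast
  finally show False by simp
qed

lemma local_Lip_finite_if_Lipschitz_on_ball:
  assumes "r > 0"
    and lip: "\<And>u v. u \<in> ball x r \<Longrightarrow> v \<in> ball x r \<Longrightarrow> \<bar>f u - f v\<bar> \<le> L * dist u v"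
  shows "local_Lip f x < \<infinity>"
proof -
  have "local_Lip f x \<le> ennreal L"
    unfolding local_Lip_def using assms
    by (intro INF_lower2[of r] SUP_least)
      (auto intro!: ennreal_leI simp: divide_le_eq)
  then show ?thesis
    using le_less_trans by fastforce
qed

section \<open>The sets underlying a Takagi--van der Waerden function\<close>

lemma infdist_lipschitz: "\<bar>infdist u T - infdist v T\<bar> \<le> dist u v"
  using infdist_triangle[of u T v] infdist_triangle[of v T u] by (auto simp: dist_commute)

lemma infdist_lessE:
  assumes "T \<noteq> {}" "infdist x T < r"
  obtains t where "t \<in> T" "dist x t < r"
  using assms cInf_lessD[of "dist x ` T" r] by (auto simp: infdist_notempty)

lemma center_subset_TW_nbhd: "a > 0 \<Longrightarrow> c > 0 \<Longrightarrow> A \<subseteq> TW_nbhd a c A n"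
  by (auto simp: TW_nbhd_def set_ball_def)

lemma ball_subset_TW_nbhd:
  assumes "a > 0" "c \<ge> 1" "x \<in> A"
  shows "ball x (1 / a ^ n) \<subseteq> TW_nbhd a c A n"
proof
  fix u
  assume "u \<in> ball x (1 / a ^ n)"
  then have "infdist u A < 1 / a ^ n"
    using infdist_le[OF assms(3), of u] by (auto simp: dist_commute)
  also have "\<dots> \<le> c / a ^ n"
    using assms by (intro divide_right_mono) auto
  finally show "u \<in> TW_nbhd a c A n"
    using assms by (auto simp: TW_nbhd_def set_ball_def)
qed

lemma closed_TW_set:
  assumes "a > 0" "maximal_separated (1 / a ^ n) (TW_nbhd a c A n) (S n)"
  shows "closed (TW_set a c A S n)"
proof -
  have "closed (S n)"
    using assms unfolding maximal_separated_def eps_separated_def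
    by (intro discrete_imp_closed[of "1 / a ^ n"]) force+
  moreover have "open (TW_nbhd a c A n)"
    unfolding TW_nbhd_def set_ball_def
    by (cases "A = {}") (simp_all add: open_Collect_less continuous_on_infdist)
  ultimately show ?thesis
    unfolding TW_set_def by (auto simp: Compl_eq_Diff_UNIV[symmetric])
qed

text \<open>
  A point of the neighbourhood at distance at least \<open>1 / a\<^sup>n\<close> from all of \<open>S n\<close> could be added
  to \<open>S n\<close>, against maximality.
\<close>

lemma infdist_TW_set_le:
  assumes "a > 0" "maximal_separated (1 / a ^ n) (TW_nbhd a c A n) (S n)"
  shows "infdist x (TW_set a c A S n) \<le> 1 / a ^ n"
proof (cases "x \<in> TW_set a c A S n")
  case True
  then show ?thesis using assms(1) by simp
next
  case False
  then have x: "x \<in> TW_nbhd a c A n" "x \<notin> S n"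
    by (auto simp: TW_set_def)
  then have "\<not> eps_separated (1 / a ^ n) (insert x (S n))"
    using assms(2) unfolding maximal_separated_def by (metis insertI1 insert_subset subset_insertI)
  then obtain s where s: "s \<in> S n" "dist x s < 1 / a ^ n"
    using assms(2) unfolding maximal_separated_def eps_separated_def
    by (auto simp: not_le dist_commute)
  then have "infdist x (TW_set a c A S n) \<le> dist x s"
    by (intro infdist_le) (auto simp: TW_set_def)
  with s show ?thesis by simp
qed

text \<open>
  Because \<open>c \<ge> 1\<close>, the complement of the \<open>n\<close>-th neighbourhood of \<open>A\<close> stays \<open>1 / a\<^sup>n\<close> away from
  \<open>x \<in> A\<close>, just as the other points of \<open>S n\<close> do.  Hence \<open>x\<close> is the nearest point of the set for
  everything within half that distance.
\<close>

lemma infdist_TW_set_near_center_point: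
  assumes "a > 0" "c \<ge> 1" "x \<in> A"
    and max: "maximal_separated (1 / a ^ n) (TW_nbhd a c A n) (S n)"
    and x: "x \<in> TW_set a c A S n"
    and u: "dist u x < 1 / (2 * a ^ n)"
  shows "infdist u (TW_set a c A S n) = dist u x"
proof (rule antisym)
  show "infdist u (TW_set a c A S n) \<le> dist u x"
    using x by (rule infdist_le)
  have far: "1 / a ^ n \<le> dist x t" if t: "t \<in> TW_set a c A S n" "t \<noteq> x" for t
  proof (cases "t \<in> TW_nbhd a c A n")
    case True
    moreover have "x \<in> TW_nbhd a c A n"
      using center_subset_TW_nbhd[of a c A n] assms(1-3) by auto
    ultimately have "t \<in> S n" "x \<in> S n"
      using t x by (auto simp: TW_set_def)
    moreover have "eps_separated (1 / a ^ n) (S n)"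
      using max by (simp add: maximal_separated_def)
    ultimately show ?thesis
      using t(2) by (auto simp: eps_separated_def)
  next
    case False
    then have "t \<notin> ball x (1 / a ^ n)"
      using ball_subset_TW_nbhd[OF assms(1-3)] by blast
    then show ?thesis by simp
  qed
  have "dist u x \<le> dist u t" if t: "t \<in> TW_set a c A S n" for t
  proof (cases "t = x")
    case False
    have "2 * (1 / (2 * a ^ n)) = 1 / a ^ n" by simp
    moreover have "dist x t \<le> dist u x + dist u t"
      by (rule dist_triangle3)
    ultimately show ?thesis
      using far[OF t False] u by linarith
  qed simp
  then show "dist u x \<le> infdist u (TW_set a c A S n)"
    using x by (auto simp: infdist_def intro: cINF_greatest)
qed

section \<open>Behaviour away from the center\<close>

lemma inverse_power_eventually_small:
  assumes "(a::real) > 1" "e > 0"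
  obtains N where "\<And>n. n \<ge> N \<Longrightarrow> c / a ^ n < e"
proof -
  have "(\<lambda>n. c / a ^ n) \<longlonglongrightarrow> 0"
    using LIMSEQ_divide_realpow_zero[of a c] assms by simp
  then have "\<forall>\<^sub>F n in sequentially. c / a ^ n < e"
    using assms(2) by (rule order_tendstoD)
  then show ?thesis
    using that unfolding eventually_sequentially by blast
qed

lemma local_Lip_finite_off_center:
  assumes rep: "TW_representation a b c A S f" and "a > 1" and "x \<notin> A"
  shows "local_Lip f x < \<infinity>"
proof -
  have cl: "closed A" and b: "b \<ge> 1"
    and sums: "\<And>u. (\<lambda>n. b ^ n * infdist u (TW_set a c A S n)) sums f u"
    using rep unfolding TW_representation_def by auto
  obtain e where e: "e > 0" "ball x e \<inter> A = {}"
    using cl \<open>x \<notin> A\<close> open_contains_ball[of "- A"] by (auto simp: open_Compl disjoint_eq_subset_Compl)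
  obtain N where N: "\<And>n. n \<ge> N \<Longrightarrow> c / a ^ n < e / 2"
    using inverse_power_eventually_small[OF \<open>a > 1\<close>, of "e / 2" c] e by auto
  have vanish: "infdist u (TW_set a c A S n) = 0" if u: "u \<in> ball x (e / 2)" and n: "n \<ge> N" for u n
  proof -
    have "u \<notin> TW_nbhd a c A n"
    proof
      assume "u \<in> TW_nbhd a c A n"
      then have "A \<noteq> {}" "infdist u A < c / a ^ n"
        by (auto simp: TW_nbhd_def set_ball_def)
      note this(1) less_trans[OF this(2) N[OF n]]
      then obtain y where y: "y \<in> A" "dist u y < e / 2"
        by (rule infdist_lessE)
      have "dist x y \<le> dist x u + dist u y"
        by (rule dist_triangle)
      then have "y \<in> ball x e"
        using y u by simp
      with e y show False by blast
    qed
    then show ?thesis by (simp add: TW_set_def)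
  qed
  have finite_sum: "f u = (\<Sum>n<N. b ^ n * infdist u (TW_set a c A S n))"
    if "u \<in> ball x (e / 2)" for u
    using sums_unique2[OF sums[of u] sums_finite[of "{..<N}"]] vanish[OF that] by auto
  show ?thesis
  proof (rule local_Lip_finite_if_Lipschitz_on_ball)
    show "e / 2 > 0" using e by simp
    fix u v
    assume uv: "u \<in> ball x (e / 2)" "v \<in> ball x (e / 2)"
    have "f u - f v
        = (\<Sum>n<N. b ^ n * (infdist u (TW_set a c A S n) - infdist v (TW_set a c A S n)))"
      unfolding finite_sum[OF uv(1)] finite_sum[OF uv(2)] by (simp add: sum_subtractf right_diff_distrib)
    also have "\<bar>\<dots>\<bar> \<le> (\<Sum>n<N. b ^ n * dist u v)"
      using b by (intro order_trans[OF sum_abs] sum_mono)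
        (auto simp: abs_mult intro!: mult_left_mono infdist_lipschitz)
    finally show "\<bar>f u - f v\<bar> \<le> (\<Sum>n<N. b ^ n) * dist u v"
      by (simp add: sum_distrib_right)
  qed
qed

section \<open>Behaviour on the center\<close>

text \<open>
  All terms of the difference series with index at least \<open>N\<close> are nonnegative, so keeping only the
  \<open>n\<close>-th of them gives a lower bound; each earlier term is Lipschitz with constant \<open>b\<^sup>k\<close>.
\<close>

lemma TW_difference_lower_bound:
  assumes rep: "TW_representation a b c A S f"
    and zero: "\<And>k. k \<ge> N \<Longrightarrow> infdist t (TW_set a c A S k) = 0"
    and n: "n \<ge> N"
  shows "b ^ n * infdist u (TW_set a c A S n) - (\<Sum>k<N. b ^ k) * dist u t \<le> f u - f t"
proof -
  define h where "h k = b ^ k * infdist u (TW_set a c A S k) - b ^ k * infdist t (TW_set a c A S k)" for k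
  have b: "b \<ge> 1" and h: "h sums (f u - f t)"
    using rep unfolding h_def TW_representation_def by (auto intro: sums_diff)
  have "- (b ^ k * dist u t) \<le> h k" for k
  proof -
    have "b ^ k * - dist u t \<le> b ^ k * (infdist u (TW_set a c A S k) - infdist t (TW_set a c A S k))"
      using infdist_lipschitz[of u "TW_set a c A S k" t] b by (intro mult_left_mono) auto
    then show ?thesis by (simp add: h_def right_diff_distrib)
  qed
  then have "(\<Sum>k<N. - (b ^ k * dist u t)) \<le> (\<Sum>k<N. h k)"
    by (rule sum_mono)
  then have "b ^ n * infdist u (TW_set a c A S n) - (\<Sum>k<N. b ^ k) * dist u t \<le> h n + (\<Sum>k<N. h k)"
    using zero[OF n] by (simp add: h_def sum_negf sum_distrib_right)
  also have "\<dots> = sum h (insert n {..<N})"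
    using n by simp
  also have "\<dots> \<le> suminf h"
    using h b zero by (intro sum_le_suminf) (auto simp: sums_iff h_def not_less infdist_nonneg)
  finally show ?thesis
    using h by (simp add: sums_iff)
qed

lemma big_Lip_infinite_at_TW_point:
  assumes rep: "TW_representation a b c A S f"
    and mono: "\<And>m n. m \<le> n \<Longrightarrow> TW_set a c A S m \<subseteq> TW_set a c A S n"
    and "b > 1" "c \<ge> 1" "x \<in> A" "x \<in> non_isolated"
    and x: "x \<in> TW_set a c A S N"
  shows "big_Lip f x = \<infinity>"
proof (rule big_Lip_infinite_if_unbounded_quotients)
  fix M \<delta> :: real
  assume "\<delta> > 0"
  have a: "a > 0" and max: "\<And>n. maximal_separated (1 / a ^ n) (TW_nbhd a c A n) (S n)"
    using rep \<open>b > 1\<close> unfolding TW_representation_def by auto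
  define C where "C = (\<Sum>k<N. b ^ k)"
  obtain n0 where "M + C < b ^ n0"
    using real_arch_pow[OF \<open>b > 1\<close>] by blast
  also have "b ^ n0 \<le> b ^ max N n0"
    using \<open>b > 1\<close> by (intro power_increasing) auto
  finally obtain n where n: "n \<ge> N" "M + C \<le> b ^ n"
    using that[of "max N n0"] by auto
  have "x islimpt UNIV"
    using \<open>x \<in> non_isolated\<close> by (simp add: non_isolated_def isolated_in_islimpt_iff)
  then obtain u where u: "u \<noteq> x" "dist u x < min \<delta> (1 / (2 * a ^ n))"
    using \<open>\<delta> > 0\<close> a unfolding islimpt_approachable
    by (auto dest!: spec[of _ "min \<delta> (1 / (2 * a ^ n))"])
  have "x \<in> TW_set a c A S k" if "k \<ge> N" for k
    using mono[OF that] x by blast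
  then have "b ^ n * infdist u (TW_set a c A S n) - C * dist u x \<le> f u - f x"
    and "infdist u (TW_set a c A S n) = dist u x"
    using TW_difference_lower_bound[OF rep _ n(1), of x u] n u max a assms(4,5)
    by (auto simp: C_def intro: infdist_TW_set_near_center_point)
  moreover have "M * dist u x \<le> (b ^ n - C) * dist u x"
    using n by (intro mult_right_mono) auto
  ultimately show "\<exists>u. u \<noteq> x \<and> dist u x < \<delta> \<and> M * dist u x \<le> \<bar>f x - f u\<bar>"
    using u by (intro exI[of _ u]) (auto simp: algebra_simps)
qed

lemma big_Lip_infinite_off_TW_sets:
  assumes rep: "TW_representation a b c A S f"
    and mono: "\<And>m n. m \<le> n \<Longrightarrow> TW_set a c A S m \<subseteq> TW_set a c A S n"
    and "b > 2"
    and x: "\<And>n. x \<notin> TW_set a c A S n"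
  shows "big_Lip f x = \<infinity>"
proof (rule big_Lip_infinite_if_unbounded_quotients)
  fix M \<delta> :: real
  assume "\<delta> > 0"
  have a: "a > 1" and max: "\<And>n. maximal_separated (1 / a ^ n) (TW_nbhd a c A n) (S n)"
    using rep \<open>b > 2\<close> unfolding TW_representation_def by auto
  \<comment> \<open>The distance to \<open>T\<^sub>n\<close> need not be attained; \<open>K\<close> is the factor by which it may be missed.
     The margin \<open>\<eta>\<close> is what remains, per unit of \<open>b\<^sup>n\<close>, of the gain after the loss.\<close>
  obtain K where K: "1 < K" "K < b - 1"
    using dense[of 1 "b - 1"] \<open>b > 2\<close> by auto
  define \<eta> where "\<eta> = 1 / K - 1 / (b - 1)"
  have "\<eta> > 0"
    using K by (simp add: \<eta>_def field_simps)
  obtain n1 where n1: "M / \<eta> < b ^ n1"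
    using real_arch_pow[of b] \<open>b > 2\<close> by auto
  obtain n2 where n2: "\<And>n. n \<ge> n2 \<Longrightarrow> K / a ^ n < \<delta>"
    using inverse_power_eventually_small[OF a \<open>\<delta> > 0\<close>] by blast
  define n where "n = max n1 n2"
  have "b ^ n1 \<le> b ^ n"
    using \<open>b > 2\<close> by (intro power_increasing) (auto simp: n_def)
  with n1 have "M / \<eta> \<le> b ^ n" by linarith
  then have M: "M \<le> b ^ n * \<eta>"
    using \<open>\<eta> > 0\<close> by (simp add: pos_divide_le_eq)
  let ?T = "TW_set a c A S n"
  have ne: "?T \<noteq> {}"
    using max by (rule TW_set_nonempty)
  have "closed ?T"
    by (rule closed_TW_set[OF _ max]) (use a in simp)
  then have "infdist x ?T > 0"
    using in_closed_iff_infdist_zero[OF _ ne, of x] x[of n] infdist_nonneg[of x ?T]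
    by (simp add: less_le)
  then have "infdist x ?T < K * infdist x ?T"
    using mult_strict_right_mono[OF K(1)] by simp
  with ne obtain t where t: "t \<in> ?T" "dist x t < K * infdist x ?T"
    by (rule infdist_lessE)
  have "K * infdist x ?T \<le> K * (1 / a ^ n)"
    using a K by (intro mult_left_mono infdist_TW_set_le[OF _ max]) simp_all
  also have "\<dots> < \<delta>"
    using n2[of n] by (simp add: n_def)
  finally have near: "dist t x < \<delta>"
    using t by (simp add: dist_commute)
  have "t \<in> TW_set a c A S k" if "k \<ge> n" for k
    using mono[OF that] t by blast
  then have "b ^ n * infdist x ?T - (\<Sum>k<n. b ^ k) * dist x t \<le> f x - f t"
    by (intro TW_difference_lower_bound[OF rep]) auto
  moreover have "b ^ n * (dist x t / K) \<le> b ^ n * infdist x ?T"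
    using t K \<open>b > 2\<close> by (intro mult_left_mono) (auto simp: field_simps)
  moreover have "(\<Sum>k<n. b ^ k) * dist x t \<le> (b ^ n / (b - 1)) * dist x t"
    using \<open>b > 2\<close> by (intro mult_right_mono) (auto simp: geometric_sum divide_right_mono)
  moreover have "M * dist x t \<le> b ^ n * \<eta> * dist x t"
    using M by (rule mult_right_mono) simp
  ultimately have "M * dist x t \<le> f x - f t"
    by (simp add: \<eta>_def algebra_simps)
  then have "M * dist t x \<le> \<bar>f x - f t\<bar>"
    by (simp add: dist_commute)
  moreover have "t \<noteq> x"
    using t x by blast
  ultimately show "\<exists>u. u \<noteq> x \<and> dist u x < \<delta> \<and> M * dist u x \<le> \<bar>f x - f u\<bar>"
    using near by blast
qed

theorem theorem4p1:
  fixes A :: "'a::metric_space set" and f :: "'a \<Rightarrow> real" and a b c :: real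
  assumes "A \<subseteq> non_isolated"
    and "closed A"
    and "a > b" and "b > 2" and "c \<ge> 1"
    and "monotone_TW_function a b c A f"
  shows "big_Lip_infinity f = A \<and> local_Lip_infinity f = A"
proof -
  obtain S where rep: "TW_representation a b c A S f"
    and "\<And>n. TW_set a c A S n \<subseteq> TW_set a c A S (Suc n)"
    using assms(6) unfolding monotone_TW_function_def by blast
  then have mono: "TW_set a c A S m \<subseteq> TW_set a c A S n" if "m \<le> n" for m n
    using that by (metis lift_Suc_mono_le)
  have "big_Lip f x = \<infinity>" if "x \<in> A" for x
  proof (cases "\<exists>N. x \<in> TW_set a c A S N")
    case True
    then show ?thesis
      using big_Lip_infinite_at_TW_point[OF rep mono] that assms(1,4,5) by auto
  next
    case False
    then show ?thesis
      using big_Lip_infinite_off_TW_sets[OF rep mono \<open>b > 2\<close>] by blast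
  qed
  then have "A \<subseteq> big_Lip_infinity f"
    by (auto simp: big_Lip_infinity_def)
  moreover have "big_Lip_infinity f \<subseteq> local_Lip_infinity f"
    using big_Lip_le_local_Lip[of f]
    by (auto simp: big_Lip_infinity_def local_Lip_infinity_def) (metis top_unique)
  moreover have "local_Lip_infinity f \<subseteq> A"
    using local_Lip_finite_off_center[OF rep] assms(3,4) by (force simp: local_Lip_infinity_def)
  ultimately show ?thesis by blast
qed

end
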